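(* Let $A$ be a finite alphabet, let $[w]$ be a primitive circular word over $A$ with linearization $w$, and let $M=\mathcal{M}_{[w]}$ be the set of minimal forbidden factors of $[w]$ (a finite antifactorial language). Let $\mathcal{T}$ be the trie recognizing $M$. Then the automaton output by algorithm L-automaton on input $\mathcal{T}$, after removing its sink states, is the minimal deterministic finite automaton recognizing the language $\mathcal{F}_{w^*}$ of factors of $[w]$.
   Context: Words are elements of the free monoid $A^*$ over a finite alphabet $A$; $\varepsilon$ is the empty word. Words $w,w'$ are conjugate if $w=uv$, $w'=vu$ for some words $u,v$; a circular word $[w]$ is a conjugacy class, and any of its elements is a linearization of it. A word $w$ is primitive if $w=v^k$ implies $k=1$; primitivity is invariant under conjugacy, and $[w]$ is primitive if $w$ is. The set of factors of $[w]$ is $\mathcal{F}_{w^*}$, the set of all words that are factors (contiguous subwords, including $\varepsilon$) of $w^k$ for some $k\ge 0$; it does not depend on the linearization. For a factorial language $L$ (one containing all factors of its words), the set of minimal forbidden factors is $$\mathcal{M}_L=\{a\in A\mid a\notin L\}\cup\{aub\mid a,b\in A,\ u\in A^*,\ aub\notin L,\ au\in L,\ ub\in L\},$$ and $\mathcal{M}_{[w]}:=\mathcal{M}_{\mathcal{F}_{w^*}}$. A language is antifactorial if no word in it is a proper factor of another word in it. Automata: a DFA is $(Q,A,i,T,\delta)$ with finite state set $Q$, initial state $i$, set of terminal states $T$ and (possibly partial) transition function $\delta$; automata are not required to be complete, so a non-accepting sink state is not counted. A DFA is minimal if it has the least number of states among all such DFAs recognizing the same language (it is then unique up to isomorphism).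 The trie of a finite antifactorial language $M$ is the tree-like DFA $\mathcal{T}=(Q,A,i,T,\delta')$ whose states are the prefixes of words of $M$ (including the root $i=\varepsilon$), with $T=M$ and transitions $\delta'(u,a)=ua$ whenever $u$ and $ua$ are both states. Algorithm L-automaton on input $\mathcal{T}=(Q,A,i,T,\delta')$ computes a transition function $\delta:Q\times A\to Q$ and a failure function $f:Q\setminus\{i\}\to Q$ as follows. First, for each $a\in A$: if $\delta'(i,a)$ is defined, set $\delta(i,a):=\delta'(i,a)$ and $f(\delta(i,a)):=i$; otherwise set $\delta(i,a):=i$. Then, for each state $p\in Q\setminus\{i\}$ in breadth-first order and each $a\in A$: if $\delta'(p,a)$ is defined, set $\delta(p,a):=\delta'(p,a)$ and $f(\delta(p,a)):=\delta(f(p),a)$; else if $p\notin T$, set $\delta(p,a):=\delta(f(p),a)$; else (i.e. $p\in T$) set $\delta(p,a):=p$. The output is the automaton $(Q,A,i,Q\setminus T,\delta)$. Its sink states are the states in $T$; removing them means deleting these states together with all transitions into or out of them. *)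

theory Defs
  imports Main "HOL-Library.Sublist"
begin

abbreviation word_power :: "'a list \<Rightarrow> nat \<Rightarrow> 'a list"  (infixr \<open>\<up>\<close> 80) where
  "w \<up> k \<equiv> concat (replicate k w)"

definition conjugate :: "'a list \<Rightarrow> 'a list \<Rightarrow> bool" where
  "conjugate w w' \<longleftrightarrow> (\<exists>u v. w = u @ v \<and> w' = v @ u)"

definition circular_word :: "'a list \<Rightarrow> 'a list set" where
  "circular_word w = {w'. conjugate w w'}"

text \<open>With \<open>k = 0\<close> allowed, the empty word is not primitive.\<close>

definition primitive :: "'a list \<Rightarrow> bool" where
  "primitive w \<longleftrightarrow> (\<forall>v k. w = v \<up> k \<longrightarrow> k = 1)"

text \<open>Since primitivity is invariant under conjugacy, requiring one linearization to be primitive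
  is the same as requiring all of them to be (lemma \<open>primitive_circular_iff\<close> below).\<close>

definition primitive_circular :: "'a list set \<Rightarrow> bool" where
  "primitive_circular C \<longleftrightarrow> (\<exists>w\<in>C. primitive w)"

lemma primitive_conjugate:
  assumes "conjugate w w'" and "primitive w'"
  shows "primitive w"
  unfolding primitive_def
proof (intro allI impI)
  fix v k assume w: "w = v \<up> k"
  obtain u x where ux: "w = u @ x" "w' = x @ u"
    using assms(1) unfolding conjugate_def by blast
  have rot1: "\<exists>v'. rotate1 (v \<up> k) = v' \<up> k" for v :: "'a list" and k
  proof (cases v)
    case (Cons a t)
    have *: "concat (replicate k (a # t)) @ [a] = a # concat (replicate k (t @ [a]))" for k
      by (induction k) auto
    have "rotate1 (v \<up> k) = (t @ [a]) \<up> k"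
    proof (cases k)
      case (Suc m)
      then show ?thesis using Cons *[of m] by simp
    qed simp
    then show ?thesis by blast
  qed auto
  have "\<exists>v'. rotate n (v \<up> k) = v' \<up> k" for n
  proof (induction n)
    case (Suc n)
    then show ?case using rot1 by (metis rotate_Suc)
  qed auto
  moreover have "w' = rotate (length u) w"
    using ux by (simp add: rotate_append)
  ultimately show "k = 1"
    using w assms(2) unfolding primitive_def by metis
qed

lemma primitive_circular_iff: "primitive_circular (circular_word w) \<longleftrightarrow> primitive w"
proof -
  have "conjugate w w" unfolding conjugate_def by auto
  then show ?thesis
    unfolding primitive_circular_def circular_word_def using primitive_conjugate by blast
qed

text \<open>\<open>star_factors w\<close> is the set of factors of the circular word of \<open>w\<close>.\<close>

definition star_factors :: "'a list \<Rightarrow> 'a list set" where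
  "star_factors w = {u. \<exists>k. sublist u (w \<up> k)}"

definition minimal_forbidden :: "'a set \<Rightarrow> 'a list set \<Rightarrow> 'a list set" where
  "minimal_forbidden A L =
     {[a] | a. a \<in> A \<and> [a] \<notin> L} \<union>
     {[a] @ u @ [b] | a u b. a \<in> A \<and> b \<in> A \<and> u \<in> lists A \<and>
        [a] @ u @ [b] \<notin> L \<and> [a] @ u \<in> L \<and> u @ [b] \<in> L}"

definition antifactorial :: "'a list set \<Rightarrow> bool" where
  "antifactorial M \<longleftrightarrow> (\<forall>u\<in>M. \<forall>v\<in>M. \<not> strict_sublist u v)"

record ('s, 'a) automaton =
  alphabet :: "'a set"
  states :: "'s set"
  init :: 's
  finals :: "'s set"
  delta :: "'s \<Rightarrow> 'a \<Rightarrow> 's option"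

definition dfa :: "('s, 'a) automaton \<Rightarrow> bool" where
  "dfa D \<longleftrightarrow> finite (alphabet D) \<and> finite (states D) \<and>
     init D \<in> states D \<and> finals D \<subseteq> states D \<and>
     (\<forall>p\<in>states D. \<forall>a\<in>alphabet D. \<forall>q. delta D p a = Some q \<longrightarrow> q \<in> states D)"

primrec run :: "('s, 'a) automaton \<Rightarrow> 's \<Rightarrow> 'a list \<Rightarrow> 's option" where
  "run D p [] = Some p"
| "run D p (a # u) = Option.bind (delta D p a) (\<lambda>q. run D q u)"

definition language :: "('s, 'a) automaton \<Rightarrow> 'a list set" where
  "language D = {u \<in> lists (alphabet D). \<exists>q\<in>finals D. run D (init D) u = Some q}"

text \<open>The type argument is the state type of the competing automata. A theorem that leaves it as a
  type variable covers competitors over every state type.\<close>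

definition minimal_dfa :: "'q itself \<Rightarrow> ('s, 'a) automaton \<Rightarrow> bool" where
  "minimal_dfa _ D \<longleftrightarrow> dfa D \<and>
     (\<forall>D' :: ('q, 'a) automaton.
        dfa D' \<and> language D' = language D \<longrightarrow> card (states D) \<le> card (states D'))"

definition remove_states :: "'s set \<Rightarrow> ('s, 'a) automaton \<Rightarrow> ('s, 'a) automaton" where
  "remove_states S D =
     \<lparr>alphabet = alphabet D, states = states D - S, init = init D, finals = finals D - S,
      delta = (\<lambda>p a. case delta D p a of
                 None \<Rightarrow> None
               | Some q \<Rightarrow> if p \<in> S \<or> q \<in> S then None else Some q)\<rparr>"

definition trie :: "'a set \<Rightarrow> 'a list set \<Rightarrow> ('a list, 'a) automaton" where
  "trie A M =
     (let Q = insert [] {u. \<exists>v\<in>M. prefix u v} in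
      \<lparr>alphabet = A, states = Q, init = [], finals = M,
       delta = (\<lambda>u a. if u \<in> Q \<and> u @ [a] \<in> Q then Some (u @ [a]) else None)\<rparr>)"

definition depth :: "('s, 'a) automaton \<Rightarrow> 's \<Rightarrow> nat" where
  "depth D p = (LEAST n. \<exists>u\<in>lists (alphabet D). length u = n \<and> run D (init D) u = Some p)"

text \<open>Any enumeration of the non-initial states by non-decreasing depth is admitted; the orders
  produced by a queue-based traversal of a tree are among them.\<close>

definition breadth_first_order :: "('s, 'a) automaton \<Rightarrow> 's list \<Rightarrow> bool" where
  "breadth_first_order D ps \<longleftrightarrow>
     distinct ps \<and> set ps = states D - {init D} \<and> sorted (map (depth D) ps)"

lemma breadth_first_order_exists:
  assumes "finite (states D)"
  shows "\<exists>ps. breadth_first_order D ps"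
proof -
  obtain xs where "set xs = states D - {init D}" "distinct xs"
    using assms finite_distinct_list[of "states D - {init D}"] by auto
  then have "breadth_first_order D (sort_key (depth D) xs)"
    unfolding breadth_first_order_def by simp
  then show ?thesis by blast
qed

text \<open>The loops act on the partially filled tables of the transition function and of the failure
  function; \<open>None\<close> marks an entry that has not been assigned.\<close>

type_synonym ('s, 'a) tables = "('s \<Rightarrow> 'a \<Rightarrow> 's option) \<times> ('s \<Rightarrow> 's option)"

abbreviation set_delta ::
    "'s \<Rightarrow> 'a \<Rightarrow> 's option \<Rightarrow> ('s \<Rightarrow> 'a \<Rightarrow> 's option) \<Rightarrow> 's \<Rightarrow> 'a \<Rightarrow> 's option" where
  "set_delta p a x d \<equiv> d(p := (d p)(a := x))"

fun root_step :: "('s, 'a) automaton \<Rightarrow> 'a \<Rightarrow> ('s, 'a) tables \<Rightarrow> ('s, 'a) tables" where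
  "root_step D a (d, f) =
     (case delta D (init D) a of
        Some q \<Rightarrow> (set_delta (init D) a (Some q) d, f(q := Some (init D)))
      | None \<Rightarrow> (set_delta (init D) a (Some (init D)) d, f))"

fun state_step :: "('s, 'a) automaton \<Rightarrow> 's \<Rightarrow> 'a \<Rightarrow> ('s, 'a) tables \<Rightarrow> ('s, 'a) tables" where
  "state_step D p a (d, f) =
     (case delta D p a of
        Some q \<Rightarrow>
          (let d' = set_delta p a (Some q) d
           in (d', f(q := Option.bind (f p) (\<lambda>r. d' r a))))
      | None \<Rightarrow>
          if p \<notin> finals D then (set_delta p a (Option.bind (f p) (\<lambda>r. d r a)) d, f)
          else (set_delta p a (Some p) d, f))"

definition L_tables :: "('s, 'a) automaton \<Rightarrow> 'a list \<Rightarrow> 's list \<Rightarrow> ('s, 'a) tables" where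
  "L_tables D ls ps =
     fold (\<lambda>p. fold (state_step D p) ls) ps
       (fold (root_step D) ls (\<lambda>_ _. None, \<lambda>_. None))"

text \<open>\<open>ls\<close> and \<open>ps\<close> are the orders in which the letters and the non-initial states are visited.\<close>

definition L_automaton ::
    "('s, 'a) automaton \<Rightarrow> 'a list \<Rightarrow> 's list \<Rightarrow> ('s, 'a) automaton" where
  "L_automaton D ls ps =
     \<lparr>alphabet = alphabet D, states = states D, init = init D, finals = states D - finals D,
      delta = fst (L_tables D ls ps)\<rparr>"

end

theory Submission
  imports Defs "HOL-Number_Theory.Cong"
begin

text \<open>A window of length \<open>|w|\<close> of a primitive circular word \<open>w\<close> occurs at a single position modulo
  \<open>|w|\<close>, since \<open>w\<close> differs from its proper rotations. Hence minimal forbidden factors have length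
  at most \<open>|w| + 1\<close>, and two factors with the same right contexts end at a common position, so the
  shorter one is a suffix of the longer one.

  The algorithm computes \<open>\<delta>(p, a)\<close> as the longest suffix of \<open>pa\<close> in the trie, so the trimmed
  automaton reads exactly the words that avoid \<open>M\<close>, which are the factors of \<open>[w]\<close>. Suppose that
  a state \<open>u\<close> and a shorter state \<open>v\<close> have the same right contexts. Removing the first letter of
  \<open>u\<close> gives a word \<open>u'\<close> that still has the suffix \<open>v\<close>, so \<open>u\<close> and \<open>u'\<close> have the same right
  contexts. But \<open>u\<close> is a proper prefix of some \<open>uy\<close> in \<open>M\<close>, where \<open>u'y\<close> is a factor and \<open>uy\<close>
  is not.\<close>

section \<open>Factors of a primitive circular word\<close>

definition occurs_at :: "'a list \<Rightarrow> nat \<Rightarrow> 'a list \<Rightarrow> bool" where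
  "occurs_at w i u \<longleftrightarrow> (\<forall>j<length u. u ! j = w ! ((i + j) mod length w))"

lemma occurs_at_append:
  "occurs_at w i (u @ v) \<longleftrightarrow> occurs_at w i u \<and> occurs_at w (i + length u) v"
proof
  assume *: "occurs_at w i (u @ v)"
  have "v ! j = w ! ((i + length u + j) mod length w)" if "j < length v" for j
    using *[unfolded occurs_at_def, rule_format, of "length u + j"] that by (simp add: add.assoc)
  moreover have "u ! j = w ! ((i + j) mod length w)" if "j < length u" for j
    using *[unfolded occurs_at_def, rule_format, of j] that by (simp add: nth_append)
  ultimately show "occurs_at w i u \<and> occurs_at w (i + length u) v"
    by (simp add: occurs_at_def)
next
  assume *: "occurs_at w i u \<and> occurs_at w (i + length u) v"
  show "occurs_at w i (u @ v)"
    unfolding occurs_at_def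
  proof (intro allI impI)
    fix j assume j: "j < length (u @ v)"
    show "(u @ v) ! j = w ! ((i + j) mod length w)"
    proof (cases "j < length u")
      case True
      then show ?thesis using * by (simp add: occurs_at_def nth_append)
    next
      case False
      then show ?thesis
        using conjunct2[OF *, unfolded occurs_at_def, rule_format, of "j - length u"] j
        by (simp add: nth_append)
    qed
  qed
qed

lemma occurs_at_cong:
  assumes "[i = i'] (mod length w)" and "occurs_at w i u"
  shows "occurs_at w i' u"
  using assms unfolding occurs_at_def cong_def by (metis mod_add_left_eq)

lemma length_word_power: "length (w \<up> k) = k * length w"
  by (induction k) auto

lemma nth_word_power: "j < k * length w \<Longrightarrow> (w \<up> k) ! j = w ! (j mod length w)"
proof (induction k arbitrary: j)
  case (Suc k)
  show ?case
  proof (cases "j < length w")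
    case True
    then show ?thesis by (simp add: nth_append)
  next
    case False
    then show ?thesis
      using Suc.IH[of "j - length w"] Suc.prems by (simp add: nth_append le_mod_geq)
  qed
qed simp

lemma star_factors_iff_occurs_at:
  assumes "w \<noteq> []"
  shows "u \<in> star_factors w \<longleftrightarrow> (\<exists>i. occurs_at w i u)"
proof
  assume "u \<in> star_factors w"
  then obtain k x y where xy: "w \<up> k = x @ u @ y"
    unfolding star_factors_def sublist_def by auto
  have len: "k * length w = length x + length u + length y"
    using arg_cong[OF xy, of length] by (simp add: length_word_power)
  have "occurs_at w 0 (w \<up> k)"
    unfolding occurs_at_def length_word_power using nth_word_power[of _ k w] by simp
  then show "\<exists>i. occurs_at w i u"
    unfolding xy occurs_at_append by blast
next
  assume "\<exists>i. occurs_at w i u"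
  then obtain i where i: "occurs_at w i u" by blast
  \<comment> \<open>A crude bound suffices: \<open>length w\<close> is at least 1, so
    \<open>k\<close> copies of \<open>w\<close> cover \<open>i + length u\<close> letters.\<close>
  define k where "k = i + length u"
  have k: "i + length u \<le> k * length w"
    using assms unfolding k_def by (cases w) auto
  have "u = take (length u) (drop i (w \<up> k))"
  proof (rule nth_equalityI)
    show "length u = length (take (length u) (drop i (w \<up> k)))"
      using k by (simp add: length_word_power)
  next
    fix j assume "j < length u"
    then show "u ! j = take (length u) (drop i (w \<up> k)) ! j"
      using i k nth_word_power[of "i + j" k w] by (simp add: occurs_at_def length_word_power)
  qed
  then show "u \<in> star_factors w"
    unfolding star_factors_def
    by (metis (mono_tags, lifting) mem_Collect_eq sublist_drop sublist_order.order_trans sublist_take)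
qed

lemma star_factors_sublist:
  "v \<in> star_factors w \<Longrightarrow> sublist u v \<Longrightarrow> u \<in> star_factors w"
  unfolding star_factors_def using sublist_order.order_trans by blast

lemma star_factors_subset_lists:
  assumes "w \<in> lists A"
  shows "star_factors w \<subseteq> lists A"
  using assms unfolding star_factors_def sublist_def by (fastforce dest: arg_cong[of _ _ set])

lemma star_factors_extend:
  assumes "w \<noteq> []" and "u \<in> star_factors w"
  shows "\<exists>x. length x = n \<and> u @ x \<in> star_factors w"
proof -
  obtain i where i: "occurs_at w i u"
    using assms star_factors_iff_occurs_at by blast
  define x where "x = map (\<lambda>j. w ! ((i + length u + j) mod length w)) [0..<n]"
  have "occurs_at w (i + length u) x"
    unfolding occurs_at_def x_def by simp
  then have "u @ x \<in> star_factors w"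
    using i assms(1) by (auto simp: star_factors_iff_occurs_at occurs_at_append)
  moreover have "length x = n" by (simp add: x_def)
  ultimately show ?thesis by blast
qed

lemma primitive_not_Nil: "primitive w \<Longrightarrow> w \<noteq> []"
  unfolding primitive_def by (metis concat.simps(1) replicate_0 zero_neq_one)

text \<open>A rotation fixing \<open>w\<close> makes a prefix and the complementary suffix commute,
  so both are powers of one word \<open>z\<close>. Then \<open>w\<close> is a power of
  \<open>z\<close> too, and primitivity leaves one of the two parts empty.\<close>

lemma primitive_rotate:
  assumes "primitive w" and "rotate d w = w"
  shows "[d = 0] (mod length w)"
proof -
  define e where "e = d mod length w"
  have e: "e < length w"
    using primitive_not_Nil[OF assms(1)] by (simp add: e_def)
  have "take e w @ drop e w = drop e w @ take e w"
    using assms(2) by (simp add: rotate_drop_take e_def)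
  then obtain m n z where z: "z \<up> m = take e w" "z \<up> n = drop e w"
    using comm_append_are_replicate by blast
  then have "w = z \<up> (m + n)"
    by (metis append_take_drop_id concat_append replicate_add)
  then have "m + n = 1"
    using assms(1) unfolding primitive_def by blast
  then have "take e w = [] \<or> drop e w = []"
    using z by (cases m) auto
  then have "e = 0" using e by auto
  then show ?thesis by (simp add: e_def cong_def)
qed

text \<open>The first \<open>length w\<close> letters of \<open>x\<close>, read at position
  \<open>i\<close>, spell \<open>rotate i w\<close>. Two positions thus give equal rotations, and
  cancelling the smaller one leaves a rotation that fixes \<open>w\<close>.\<close>

lemma primitive_occurs_at_unique:
  assumes "primitive w" and "length w \<le> length x"
    and "occurs_at w i x" and "occurs_at w i' x"
  shows "[i = i'] (mod length w)"
proof -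
  have window: "rotate k w = take (length w) x" if "occurs_at w k x" for k
    using that assms(2) by (intro nth_equalityI) (auto simp: occurs_at_def nth_rotate)
  have *: "[k = k'] (mod length w)" if "k \<le> k'" "rotate k w = rotate k' w" for k k'
  proof -
    have "rotate k w = rotate k (rotate (k' - k) w)"
      using that by (simp add: rotate_rotate)
    then have "rotate (k' - k) w = w"
      using inj_fn[OF inj_rotate1, of k] unfolding rotate_def[symmetric] by (metis injD)
    then have "[k' - k = 0] (mod length w)"
      by (rule primitive_rotate[OF assms(1)])
    then show ?thesis
      using that(1) by (metis cong_diff_iff_cong_0_nat cong_sym)
  qed
  show ?thesis
    using *[of i i'] *[of i' i] window[OF assms(3)] window[OF assms(4)]
    by (metis cong_sym nat_le_linear)
qed

text \<open>The overlap \<open>u\<close> is long enough to determine its position modulo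
  \<open>length w\<close>, so the two occurrences line up.\<close>

lemma star_factors_glue:
  assumes "primitive w" and "length w \<le> length u"
    and "x @ u \<in> star_factors w" and "u @ y \<in> star_factors w"
  shows "x @ u @ y \<in> star_factors w"
proof -
  have w: "w \<noteq> []" by (rule primitive_not_Nil[OF assms(1)])
  obtain i i' where i: "occurs_at w i (x @ u)" and i': "occurs_at w i' (u @ y)"
    using assms(3,4) star_factors_iff_occurs_at[OF w] by blast
  have "[i' = i + length x] (mod length w)"
    using primitive_occurs_at_unique[OF assms(1,2)] i i' by (simp add: occurs_at_append)
  then have "occurs_at w (i + length x) (u @ y)"
    using occurs_at_cong i' by blast
  then have "occurs_at w i (x @ u @ y)"
    using i by (simp add: occurs_at_append)
  then show ?thesis using star_factors_iff_occurs_at[OF w] by blast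
qed

text \<open>The start of \<open>x\<close> is determined modulo \<open>length w\<close>, so
  \<open>u\<close> and \<open>v\<close> end at the same place and agree letter by letter from the
  right.\<close>

lemma star_factors_common_extension:
  assumes "primitive w" and "length w \<le> length x" and "length v \<le> length u"
    and "u @ x \<in> star_factors w" and "v @ x \<in> star_factors w"
  shows "suffix v u"
proof -
  have w: "w \<noteq> []" by (rule primitive_not_Nil[OF assms(1)])
  define p s where "p = take (length u - length v) u" and "s = drop (length u - length v) u"
  have u: "u = p @ s" and len: "length s = length v"
    using assms(3) by (auto simp: p_def s_def)
  obtain i i' where i: "occurs_at w i (p @ s @ x)" and i': "occurs_at w i' (v @ x)"
    using assms(4,5) star_factors_iff_occurs_at[OF w] unfolding u by auto
  have "[i + length p + length v = i' + length v] (mod length w)"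
    using primitive_occurs_at_unique[OF assms(1,2)] i i' len by (simp add: occurs_at_append)
  then have "[i + length p = i'] (mod length w)"
    by (simp add: cong_add_rcancel_nat)
  then have "occurs_at w i' s"
    using i occurs_at_cong by (auto simp: occurs_at_append)
  moreover have "occurs_at w i' v" using i' by (simp add: occurs_at_append)
  ultimately have "s = v"
    using len by (intro nth_equalityI) (simp_all add: occurs_at_def)
  then show ?thesis using u by (simp add: suffix_def)
qed

section \<open>Minimal forbidden words\<close>

lemma minimal_forbidden_subset_lists: "minimal_forbidden A L \<subseteq> lists A"
  unfolding minimal_forbidden_def by auto

lemma minimal_forbidden_not_mem: "m \<in> minimal_forbidden A L \<Longrightarrow> m \<notin> L"
  unfolding minimal_forbidden_def by auto

lemma minimal_forbidden_not_Nil: "[] \<notin> minimal_forbidden A L"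
  unfolding minimal_forbidden_def by auto

lemma minimal_forbidden_butlast_tl:
  assumes "m \<in> minimal_forbidden A L" and "[] \<in> L"
  shows "butlast m \<in> L" and "tl m \<in> L"
  using assms unfolding minimal_forbidden_def by (auto simp: butlast_append)

text \<open>This carries the two conditions in \<open>minimal_forbidden\<close>, on the word without
  its last letter and without its first, over to all proper factors.\<close>

lemma strict_sublist_butlast_or_tl:
  assumes "strict_sublist u v"
  shows "sublist u (butlast v) \<or> sublist u (tl v)"
proof -
  obtain p s where v: "v = p @ u @ s"
    using assms unfolding strict_sublist_def sublist_def by blast
  then have "p \<noteq> [] \<or> s \<noteq> []"
    using assms unfolding strict_sublist_def by auto
  then show ?thesis
    unfolding v by (cases p; cases s rule: rev_cases) (auto simp: butlast_append)
qed

text \<open>The algorithm is proved correct for any factorial language. Primitivity of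
  \<open>w\<close> serves for the finiteness of \<open>minimal_forbidden\<close> and for the
  separation of states.\<close>

locale factorial_language =
  fixes A :: "'a set" and L :: "'a list set"
  assumes L_lists: "L \<subseteq> lists A"
    and L_Nil: "[] \<in> L"
    and L_sublist: "\<And>u v. v \<in> L \<Longrightarrow> sublist u v \<Longrightarrow> u \<in> L"
begin

lemma minimal_forbidden_strict_sublist:
  assumes "m \<in> minimal_forbidden A L" and "strict_sublist u m"
  shows "u \<in> L"
  using strict_sublist_butlast_or_tl[OF assms(2)]
    minimal_forbidden_butlast_tl[OF assms(1) L_Nil] L_sublist by blast

lemma antifactorial_minimal_forbidden: "antifactorial (minimal_forbidden A L)"
  unfolding antifactorial_def
  using minimal_forbidden_strict_sublist minimal_forbidden_not_mem by blast

text \<open>Letters are dropped from the left as long as the rest stays outside \<open>L\<close>.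
  The last word outside \<open>L\<close> is minimal forbidden: without its last letter it is a
  suffix of \<open>u\<close>, hence in \<open>L\<close>.\<close>

lemma minimal_forbidden_suffix:
  assumes "u @ [a] \<in> lists A" and "u \<in> L" and "u @ [a] \<notin> L"
  shows "\<exists>m\<in>minimal_forbidden A L. suffix m (u @ [a])"
  using assms
proof (induction u)
  case Nil
  then have "[a] \<in> minimal_forbidden A L"
    unfolding minimal_forbidden_def by auto
  then show ?case by auto
next
  case (Cons b u)
  show ?case
  proof (cases "u @ [a] \<in> L")
    case True
    then have "[b] @ u @ [a] \<in> minimal_forbidden A L"
      using Cons.prems unfolding minimal_forbidden_def by auto
    then show ?thesis by (metis append_Cons append_Nil suffix_order.order_refl)
  next
    case False
    have "u \<in> L"
      using L_sublist[OF Cons.prems(2)] by (simp add: sublist_Cons_right)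
    then show ?thesis
      using Cons.IH Cons.prems(1) False by (auto simp: suffix_Cons)
  qed
qed

end

text \<open>If the middle part \<open>u\<close> of a minimal forbidden word \<open>a u b\<close> had
  length at least \<open>length w\<close>, gluing \<open>a u\<close> and \<open>u b\<close> along
  \<open>u\<close> would make the whole word a factor. This bounds the length.\<close>

lemma finite_minimal_forbidden_star_factors:
  assumes "finite A" and "primitive w"
  shows "finite (minimal_forbidden A (star_factors w))"
proof (rule finite_subset)
  show "finite {u. set u \<subseteq> A \<and> length u \<le> length w + 1}"
    by (rule finite_lists_length_le[OF assms(1)])
  have "length u < length w"
    if "[a] @ u \<in> star_factors w" "u @ [b] \<in> star_factors w"
      "[a] @ u @ [b] \<notin> star_factors w" for a u b
    using star_factors_glue[OF assms(2) _ that(1,2)] that(3) by force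
  then show "minimal_forbidden A (star_factors w) \<subseteq> {u. set u \<subseteq> A \<and> length u \<le> length w + 1}"
    using primitive_not_Nil[OF assms(2)] unfolding minimal_forbidden_def
    by (fastforce simp: Suc_le_eq)
qed

section \<open>Correctness of the algorithm\<close>

text \<open>The intended state after reading a word, as in the Aho-Corasick automaton. The failure
  function at \<open>p\<close> should be \<open>longest_suffix Q (tl p)\<close>.\<close>

primrec longest_suffix :: "'a list set \<Rightarrow> 'a list \<Rightarrow> 'a list" where
  "longest_suffix Q [] = []"
| "longest_suffix Q (a # u) = (if a # u \<in> Q then a # u else longest_suffix Q u)"

lemma suffix_longest_suffix: "suffix (longest_suffix Q u) u"
  by (induction u) (auto simp: suffix_Cons)

lemma longest_suffix_mem: "[] \<in> Q \<Longrightarrow> longest_suffix Q u \<in> Q"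
  by (induction u) auto

lemma longest_suffix_id: "u \<in> Q \<Longrightarrow> longest_suffix Q u = u"
  by (cases u) auto

lemma suffix_longest_suffixI: "v \<in> Q \<Longrightarrow> suffix v u \<Longrightarrow> suffix v (longest_suffix Q u)"
  by (induction u) (auto simp: suffix_Cons)

text \<open>By the assumption, a nonempty suffix of \<open>u @ [a]\<close> in \<open>Q\<close> is a
  suffix of \<open>u\<close> in \<open>Q\<close> followed by \<open>a\<close>. So the current state
  alone determines the next one.\<close>

lemma longest_suffix_snoc:
  assumes "\<And>u. u @ [a] \<in> Q \<Longrightarrow> u \<in> Q"
  shows "longest_suffix Q (longest_suffix Q u @ [a]) = longest_suffix Q (u @ [a])"
proof (induction u)
  case (Cons b u)
  then show ?case using assms[of "b # u"] by auto
qed simp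

lemma run_append: "run D p (u @ v) = Option.bind (run D p u) (\<lambda>q. run D q v)"
  by (induction u arbitrary: p) (auto split: Option.bind_split)

section \<open>The trie of an antifactorial language\<close>

locale antifactorial_trie =
  fixes A :: "'a set" and M :: "'a list set"
  assumes M_lists: "M \<subseteq> lists A"
    and M_not_Nil: "[] \<notin> M"
    and M_antifactorial: "antifactorial M"
begin

abbreviation Q :: "'a list set" where
  "Q \<equiv> states (trie A M)"

lemma Q_def: "Q = insert [] {u. \<exists>v\<in>M. prefix u v}"
  by (simp add: trie_def Let_def)

lemma trie_simps [simp]:
  "alphabet (trie A M) = A" "init (trie A M) = []" "finals (trie A M) = M"
  by (simp_all add: trie_def Let_def)

lemma Nil_Q: "[] \<in> Q" by (simp add: Q_def)

lemma M_subset_Q: "M \<subseteq> Q" by (auto simp: Q_def)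

lemma Q_prefix: "u @ v \<in> Q \<Longrightarrow> u \<in> Q"
  unfolding Q_def by (auto dest: append_prefixD)

lemma Q_lists: "Q \<subseteq> lists A"
  unfolding Q_def using M_lists set_mono_prefix by fastforce

lemma delta_trie: "delta (trie A M) u a = (if u @ [a] \<in> Q then Some (u @ [a]) else None)"
  using Q_prefix[of u "[a]"] by (simp add: trie_def Let_def)

text \<open>The state \<open>p\<close> is a prefix of some word of \<open>M\<close>, which then
  contains \<open>m\<close> and equals it by antifactoriality. So \<open>p\<close> is squeezed
  between \<open>m\<close> and \<open>m\<close>.\<close>

lemma sublist_M_Q:
  assumes "m \<in> M" and "p \<in> Q" and "sublist m p"
  shows "p = m"
proof -
  have "p \<noteq> []" using assms M_not_Nil by auto
  then obtain m' where m': "m' \<in> M" "prefix p m'"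
    using assms(2) by (auto simp: Q_def)
  then have "m = m'"
    using assms M_antifactorial prefix_imp_sublist unfolding antifactorial_def
    by (metis sublist_order.dual_order.trans sublist_order.le_less)
  then show ?thesis
    using assms(3) m'(2) by (metis prefix_imp_sublist sublist_order.dual_order.antisym)
qed

text \<open>The failure state is a factor of \<open>p\<close>; in \<open>M\<close> it would equal
  \<open>p\<close>, yet it is shorter. The algorithm therefore never copies from a sink, whose row
  holds loops instead of longest suffixes.\<close>

lemma longest_suffix_tl_notin_M:
  assumes "p \<in> Q" and "p \<noteq> []"
  shows "longest_suffix Q (tl p) \<notin> M"
proof
  assume *: "longest_suffix Q (tl p) \<in> M"
  have suf: "suffix (longest_suffix Q (tl p)) (tl p)"
    by (rule suffix_longest_suffix)
  then have "sublist (longest_suffix Q (tl p)) p"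
    by (metis suffix_imp_sublist sublist_tl sublist_order.order_trans)
  then have "p = longest_suffix Q (tl p)"
    using sublist_M_Q[OF * assms(1)] by blast
  then have "length p \<le> length (tl p)"
    using suffix_length_le[OF suf] by metis
  then show False using assms(2) by (cases p) auto
qed

lemma longest_suffix_Q_snoc:
  "longest_suffix Q (longest_suffix Q u @ [a]) = longest_suffix Q (u @ [a])"
  by (rule longest_suffix_snoc) (rule Q_prefix)

lemma run_trie: "run (trie A M) p u = Some q \<Longrightarrow> q = p @ u"
proof (induction u arbitrary: p)
  case (Cons a u)
  then have "run (trie A M) (p @ [a]) u = Some q"
    by (auto simp: delta_trie split: if_splits)
  then show ?case using Cons.IH[of "p @ [a]"] by simp
qed simp

lemma run_trie_Nil: "u \<in> Q \<Longrightarrow> run (trie A M) [] u = Some u"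
proof (induction u rule: rev_induct)
  case (snoc a u)
  then show ?case using Q_prefix[of u "[a]"] by (simp add: run_append delta_trie)
qed simp

text \<open>Only \<open>u\<close> itself leads from the root to \<open>u\<close>, so a breadth-first
  order is one sorted by length.\<close>

lemma depth_trie:
  assumes "u \<in> Q"
  shows "depth (trie A M) u = length u"
proof -
  have "(\<exists>v\<in>lists A. length v = n \<and> run (trie A M) [] v = Some u) \<longleftrightarrow> n = length u" for n
    using assms Q_lists run_trie[of "[]"] run_trie_Nil by fastforce
  then show ?thesis unfolding depth_def by (simp add: Least_equality)
qed

section \<open>Invariants of the loops\<close>

text \<open>The invariant once the states in \<open>P\<close> have been processed. Rows of sinks are
  left open, since sinks get removed; the failure value of \<open>q\<close> is written while its
  parent \<open>butlast q\<close> is processed.\<close>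

definition tables_ok :: "'a list set \<Rightarrow> ('a list, 'a) tables \<Rightarrow> bool" where
  "tables_ok P t \<longleftrightarrow>
     (\<forall>p\<in>P - M. \<forall>a\<in>A. fst t p a = Some (longest_suffix Q (p @ [a]))) \<and>
     (\<forall>q\<in>Q. q \<noteq> [] \<longrightarrow> butlast q \<in> P \<longrightarrow> snd t q = Some (longest_suffix Q (tl q)))"

text \<open>The invariant inside one state \<open>p\<close>, where the letters in \<open>B\<close>
  have been handled.\<close>

definition state_ok :: "'a list \<Rightarrow> 'a set \<Rightarrow> ('a list, 'a) tables \<Rightarrow> bool" where
  "state_ok p B t \<longleftrightarrow>
     (\<forall>a\<in>B. p \<notin> M \<longrightarrow> fst t p a = Some (longest_suffix Q (p @ [a]))) \<and>
     (\<forall>a\<in>B. p @ [a] \<in> Q \<longrightarrow> snd t (p @ [a]) = Some (longest_suffix Q (tl (p @ [a]))))"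

lemma tables_ok_insert:
  assumes "tables_ok P t" and "state_ok p A t"
  shows "tables_ok (insert p P) t"
proof -
  have "snd t q = Some (longest_suffix Q (tl q))" if "q \<in> Q" "q \<noteq> []" "butlast q = p" for q
  proof -
    have q: "q = p @ [last q]" using that by auto
    then have "last q \<in> A"
      using that(1) Q_lists by (metis append_in_lists_conv in_mono Cons_in_lists_iff)
    then show ?thesis
      using assms(2) q that(1) unfolding state_ok_def by metis
  qed
  then show ?thesis
    using assms unfolding tables_ok_def state_ok_def by auto
qed

lemma root_step_ok:
  assumes "state_ok [] B t" and "a \<in> A"
  shows "state_ok [] (insert a B) (root_step (trie A M) a t)"
  using assms M_not_Nil by (cases t) (auto simp: state_ok_def delta_trie)

lemma root_loop_ok:
  assumes "set ls \<subseteq> A" and "state_ok [] B t"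
  shows "state_ok [] (B \<union> set ls) (fold (root_step (trie A M)) ls t)"
  using assms
proof (induction ls arbitrary: B t)
  case (Cons a ls)
  then show ?case using root_step_ok[of B t a] Cons.IH[of "insert a B"] by simp
qed simp

text \<open>With the parent in \<open>P\<close> the value \<open>f p\<close> is known, and with the
  failure state in \<open>P\<close> its row is known. If \<open>p @ [a]\<close> is no state, its
  longest suffix survives dropping the first letter, which yields the copied entry.\<close>

lemma state_step_ok:
  assumes ok: "tables_ok P t" "state_ok p B t"
    and p: "p \<in> Q" "p \<noteq> []" "butlast p \<in> P" "longest_suffix Q (tl p) \<in> P"
    and a: "a \<in> A"
  shows "tables_ok P (state_step (trie A M) p a t) \<and>
    state_ok p (insert a B) (state_step (trie A M) p a t)"
proof -
  obtain d f where t: "t = (d, f)" by (cases t)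
  define r where "r = longest_suffix Q (tl p)"
  have r_M: "r \<notin> M" using longest_suffix_tl_notin_M p(1,2) by (simp add: r_def)
  have "length r \<le> length (tl p)"
    unfolding r_def using suffix_longest_suffix suffix_length_le by blast
  \<comment> \<open>Hence writing to row \<open>p\<close> leaves the entry read from row
    \<open>r\<close> untouched.\<close>
  then have r_p: "r \<noteq> p" using p(2) by (cases p) auto
  have fp: "f p = Some r"
    using ok(1) p unfolding tables_ok_def t r_def by simp
  have dr: "d r a = Some (longest_suffix Q (tl p @ [a]))"
    using ok(1) p(4) r_M a longest_suffix_Q_snoc[of "tl p" a]
    unfolding tables_ok_def t r_def by simp
  show ?thesis
  proof (cases "p @ [a] \<in> Q")
    case True
    have "state_step (trie A M) p a t =
        (set_delta p a (Some (p @ [a])) d, f(p @ [a] := Some (longest_suffix Q (tl p @ [a]))))"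
      using True fp dr r_p by (simp add: t delta_trie Let_def)
    then show ?thesis
      using ok True p(2) by (auto simp: t tables_ok_def state_ok_def longest_suffix_id)
  next
    case False
    have *: "longest_suffix Q (p @ [a]) = longest_suffix Q (tl p @ [a])"
      using False p(2) by (cases p) auto
    have "state_step (trie A M) p a t =
        (set_delta p a (if p \<in> M then Some p else Some (longest_suffix Q (p @ [a]))) d, f)"
      using False fp dr * by (simp add: t delta_trie)
    then show ?thesis
      using ok False by (auto simp: t tables_ok_def state_ok_def)
  qed
qed

lemma state_loop_ok:
  assumes "tables_ok P t" "state_ok p B t"
    and "p \<in> Q" "p \<noteq> []" "butlast p \<in> P" "longest_suffix Q (tl p) \<in> P"
    and "set ls \<subseteq> A"
  shows "tables_ok P (fold (state_step (trie A M) p) ls t) \<and>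
    state_ok p (B \<union> set ls) (fold (state_step (trie A M) p) ls t)"
  using assms
proof (induction ls arbitrary: B t)
  case (Cons a ls)
  then show ?case
    using state_step_ok[OF Cons.prems(1-6), of a] Cons.IH[of "state_step (trie A M) p a t" "insert a B"]
    by simp
qed simp

text \<open>The parent and the failure state of \<open>p\<close> are both shorter than
  \<open>p\<close>, so the last assumption places them among the states already processed.\<close>

lemma states_loop_ok:
  assumes "set ls = A" and "tables_ok {[]} t"
    and "\<And>ys p zs. ps = ys @ p # zs \<Longrightarrow>
      p \<in> Q \<and> p \<noteq> [] \<and> (\<forall>q\<in>Q. length q < length p \<longrightarrow> q \<in> insert [] (set ys))"
  shows "tables_ok (insert [] (set ps)) (fold (\<lambda>p. fold (state_step (trie A M) p) ls) ps t)"
  using assms(3)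
proof (induction ps rule: rev_induct)
  case Nil
  show ?case using assms(2) by simp
next
  case (snoc p ps)
  have p: "p \<in> Q" "p \<noteq> []" and shorter: "\<And>q. q \<in> Q \<Longrightarrow> length q < length p \<Longrightarrow> q \<in> insert [] (set ps)"
    using snoc.prems[of ps p "[]"] by auto
  have "tables_ok (insert [] (set ps)) (fold (\<lambda>p. fold (state_step (trie A M) p) ls) ps t)"
  proof (rule snoc.IH)
    fix ys p' zs assume "ps = ys @ p' # zs"
    then show "p' \<in> Q \<and> p' \<noteq> [] \<and> (\<forall>q\<in>Q. length q < length p' \<longrightarrow> q \<in> insert [] (set ys))"
      using snoc.prems[of ys p' "zs @ [p]"] by simp
  qed
  moreover have "butlast p \<in> insert [] (set ps)"
    using p Q_prefix[of "butlast p" "[last p]"] by (intro shorter) auto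
  moreover have "longest_suffix Q (tl p) \<in> insert [] (set ps)"
  proof (rule shorter)
    show "longest_suffix Q (tl p) \<in> Q" by (rule longest_suffix_mem[OF Nil_Q])
    have "length (longest_suffix Q (tl p)) \<le> length (tl p)"
      using suffix_longest_suffix suffix_length_le by blast
    then show "length (longest_suffix Q (tl p)) < length p"
      using p(2) by (cases p) auto
  qed
  moreover have "state_ok p {} t'" for t' by (simp add: state_ok_def)
  ultimately have "tables_ok (insert p (insert [] (set ps)))
      (fold (state_step (trie A M) p) ls (fold (\<lambda>p. fold (state_step (trie A M) p) ls) ps t))"
    using state_loop_ok[OF _ _ p, of "insert [] (set ps)" _ "{}" ls] tables_ok_insert assms(1)
    by simp
  then show ?case by (simp add: insert_commute)
qed

lemma breadth_first_order_shorter: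
  assumes "breadth_first_order (trie A M) ps" and "ps = ys @ p # zs"
  shows "p \<in> Q \<and> p \<noteq> [] \<and> (\<forall>q\<in>Q. length q < length p \<longrightarrow> q \<in> insert [] (set ys))"
proof -
  have set: "set ps = Q - {[]}" and sorted: "sorted (map (depth (trie A M)) ps)"
    using assms(1) by (auto simp: breadth_first_order_def)
  have p: "p \<in> Q" "p \<noteq> []" using set assms(2) by auto
  have "q \<in> insert [] (set ys)" if q: "q \<in> Q" "length q < length p" for q
  proof (rule ccontr)
    assume "\<not> ?thesis"
    then have "q \<in> set (p # zs)" using set assms(2) q by auto
    then have "depth (trie A M) p \<le> depth (trie A M) q"
      using sorted assms(2) by (auto simp: sorted_append)
    then show False using q p by (simp add: depth_trie)
  qed
  then show ?thesis using p by blast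
qed

lemma L_tables_ok:
  assumes "set ls = A" and "breadth_first_order (trie A M) ps"
  shows "tables_ok Q (L_tables (trie A M) ls ps)"
proof -
  have "state_ok [] {} t" for t by (simp add: state_ok_def)
  then have "state_ok [] A (fold (root_step (trie A M)) ls (\<lambda>_ _. None, \<lambda>_. None))"
    using root_loop_ok[of ls "{}"] assms(1) by simp
  moreover have "tables_ok {} t" for t by (simp add: tables_ok_def)
  ultimately have "tables_ok {[]} (fold (root_step (trie A M)) ls (\<lambda>_ _. None, \<lambda>_. None))"
    using tables_ok_insert by blast
  then have "tables_ok (insert [] (set ps)) (L_tables (trie A M) ls ps)"
    unfolding L_tables_def
    using states_loop_ok[OF assms(1)] breadth_first_order_shorter[OF assms(2)] by blast
  moreover have "insert [] (set ps) = Q"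
    using assms(2) Nil_Q by (auto simp: breadth_first_order_def)
  ultimately show ?thesis by simp
qed

section \<open>The automaton without its sinks\<close>

definition trimmed :: "'a list \<Rightarrow> 'a list list \<Rightarrow> ('a list, 'a) automaton" where
  "trimmed ls ps = remove_states M (L_automaton (trie A M) ls ps)"

lemma trimmed_simps [simp]:
  "alphabet (trimmed ls ps) = A" "states (trimmed ls ps) = Q - M"
  "init (trimmed ls ps) = []" "finals (trimmed ls ps) = Q - M"
  by (auto simp: trimmed_def remove_states_def L_automaton_def)

lemma delta_trimmed:
  assumes "set ls = A" and "breadth_first_order (trie A M) ps" and "p \<in> Q - M" and "a \<in> A"
  shows "delta (trimmed ls ps) p a =
    (if longest_suffix Q (p @ [a]) \<in> M then None else Some (longest_suffix Q (p @ [a])))"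
proof -
  have "fst (L_tables (trie A M) ls ps) p a = Some (longest_suffix Q (p @ [a]))"
    using L_tables_ok[OF assms(1,2)] assms(3,4) unfolding tables_ok_def by blast
  then show ?thesis
    using assms(3) by (simp add: trimmed_def remove_states_def L_automaton_def)
qed

lemma dfa_trimmed:
  assumes "finite A" and "finite M"
    and "set ls = A" and "breadth_first_order (trie A M) ps"
  shows "dfa (trimmed ls ps)"
proof -
  have "Q = insert [] (\<Union>v\<in>M. set (prefixes v))"
    by (auto simp: Q_def)
  then have "finite Q" using assms(2) by simp
  then show ?thesis
    using assms Nil_Q M_not_Nil longest_suffix_mem
    by (auto simp: dfa_def delta_trimmed split: if_splits)
qed

end

section \<open>The automaton of a factorial language\<close>

context factorial_language
begin

sublocale antifactorial_trie A "minimal_forbidden A L"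
  using minimal_forbidden_subset_lists minimal_forbidden_not_Nil
    antifactorial_minimal_forbidden
  by unfold_locales

lemma state_proper_prefix:
  assumes "u \<in> Q - minimal_forbidden A L" and "u \<noteq> []"
  obtains y where "u @ y \<in> minimal_forbidden A L" "y \<noteq> []"
proof -
  obtain m where "m \<in> minimal_forbidden A L" "prefix u m"
    using assms by (auto simp: Q_def)
  then obtain y where y: "u @ y \<in> minimal_forbidden A L"
    by (auto simp: prefix_def)
  then have "y \<noteq> []" using assms(1) by auto
  then show ?thesis using that y by blast
qed

lemma state_mem_L:
  assumes "u \<in> Q - minimal_forbidden A L"
  shows "u \<in> L"
proof (cases "u = []")
  case False
  then obtain y where "u @ y \<in> minimal_forbidden A L" "y \<noteq> []"
    using state_proper_prefix assms by blast
  moreover from this have "strict_sublist u (u @ y)"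
    by (simp add: strict_sublist_def)
  ultimately show ?thesis
    using minimal_forbidden_strict_sublist by blast
qed (simp add: L_Nil)

text \<open>If \<open>u @ [a]\<close> leaves \<open>L\<close>, it has a minimal forbidden suffix
  \<open>m\<close>. The longest suffix in \<open>Q\<close> contains \<open>m\<close>, and a state
  containing a minimal forbidden word equals it. So the deleted transitions are those that leave
  \<open>L\<close>.\<close>

lemma longest_suffix_mem_minimal_forbidden_iff:
  assumes "u \<in> L" and "u @ [a] \<in> lists A"
  shows "longest_suffix Q (u @ [a]) \<in> minimal_forbidden A L \<longleftrightarrow> u @ [a] \<notin> L"
proof
  assume "longest_suffix Q (u @ [a]) \<in> minimal_forbidden A L"
  then show "u @ [a] \<notin> L"
    using L_sublist minimal_forbidden_not_mem suffix_imp_sublist suffix_longest_suffix by metis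
next
  assume "u @ [a] \<notin> L"
  then obtain m where m: "m \<in> minimal_forbidden A L" "suffix m (u @ [a])"
    using minimal_forbidden_suffix[OF assms(2,1)] by blast
  then have "suffix m (longest_suffix Q (u @ [a]))"
    using suffix_longest_suffixI M_subset_Q by blast
  then have "longest_suffix Q (u @ [a]) = m"
    using sublist_M_Q m(1) longest_suffix_mem[OF Nil_Q] suffix_imp_sublist by blast
  then show "longest_suffix Q (u @ [a]) \<in> minimal_forbidden A L"
    using m(1) by simp
qed

lemma run_trimmed:
  assumes "set ls = A" and "breadth_first_order (trie A (minimal_forbidden A L)) ps"
    and "u \<in> lists A"
  shows "run (trimmed ls ps) [] u = (if u \<in> L then Some (longest_suffix Q u) else None)"
  using assms(3)
proof (induction u rule: rev_induct)
  case Nil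
  show ?case using L_Nil by simp
next
  case (snoc a u)
  have a: "a \<in> A" and u: "u \<in> lists A" using snoc.prems by auto
  show ?case
  proof (cases "u \<in> L")
    case True
    \<comment> \<open>As a suffix of \<open>u\<close> the current state is in \<open>L\<close>, so
      it is no sink and its row is known.\<close>
    have "longest_suffix Q u \<in> L"
      using L_sublist[OF True] suffix_imp_sublist[OF suffix_longest_suffix] by blast
    then have "longest_suffix Q u \<in> Q - minimal_forbidden A L"
      using longest_suffix_mem[OF Nil_Q] minimal_forbidden_not_mem by blast
    then have "run (trimmed ls ps) [] (u @ [a]) =
        (if longest_suffix Q (u @ [a]) \<in> minimal_forbidden A L then None
         else Some (longest_suffix Q (u @ [a])))"
      using snoc.IH[OF u] True delta_trimmed[OF assms(1,2) _ a]
      by (simp add: run_append longest_suffix_Q_snoc)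
    then show ?thesis
      using longest_suffix_mem_minimal_forbidden_iff[OF True snoc.prems] by simp
  next
    case False
    then have "u @ [a] \<notin> L" using L_sublist by blast
    then show ?thesis using False snoc.IH[OF u] by (simp add: run_append)
  qed
qed

lemma language_trimmed:
  assumes "set ls = A" and "breadth_first_order (trie A (minimal_forbidden A L)) ps"
  shows "language (trimmed ls ps) = L"
proof -
  have "longest_suffix Q u \<in> Q - minimal_forbidden A L" if "u \<in> L" for u
    using that L_sublist longest_suffix_mem[OF Nil_Q] minimal_forbidden_not_mem
      suffix_imp_sublist[OF suffix_longest_suffix] by blast
  then have "u \<in> language (trimmed ls ps) \<longleftrightarrow> u \<in> L" if "u \<in> lists A" for u
    using that run_trimmed[OF assms that] by (auto simp: language_def)
  then show ?thesis
    using L_lists by (auto simp: language_def)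
qed

end

section \<open>Minimality by separation of states\<close>

text \<open>Each state is a word of the language, so it has a run in any competitor
  \<open>D'\<close>. The map to the state reached there is injective, because words reaching the
  same state have the same right contexts.\<close>

lemma minimal_dfaI:
  assumes "dfa D" and "states D \<subseteq> language D"
    and sep: "\<And>u v. u \<in> states D \<Longrightarrow> v \<in> states D \<Longrightarrow>
      (\<And>x. u @ x \<in> language D \<longleftrightarrow> v @ x \<in> language D) \<Longrightarrow> u = v"
  shows "minimal_dfa TYPE('q) D"
  unfolding minimal_dfa_def
proof (intro conjI allI impI)
  fix D' :: "('q, 'a) automaton"
  assume D': "dfa D' \<and> language D' = language D"
  define g where "g u = the (run D' (init D') u)" for u
  have run_states: "run D' p u = Some q \<Longrightarrow> q \<in> states D'"
    if "p \<in> states D'" "u \<in> lists (alphabet D')" for p u q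
    using that
  proof (induction u arbitrary: p)
    case (Cons a u)
    then obtain p' where "delta D' p a = Some p'" "run D' p' u = Some q"
      by (auto simp: bind_eq_Some_conv)
    moreover from this have "p' \<in> states D'"
      using Cons.prems D' by (auto simp: dfa_def)
    ultimately show ?case using Cons by simp
  qed simp
  have run: "run D' (init D') u = Some (g u)" "u \<in> lists (alphabet D')" if "u \<in> states D" for u
  proof -
    \<comment> \<open>The competitor may have another alphabet, so both the run and the membership
      in \<open>lists (alphabet D')\<close> are drawn from its language.\<close>
    have "u \<in> language D'" using that assms(2) D' by auto
    then show "run D' (init D') u = Some (g u)" "u \<in> lists (alphabet D')"
      by (auto simp: g_def language_def)
  qed
  have "g ` states D \<subseteq> states D'"
  proof (rule image_subsetI)
    fix u assume "u \<in> states D"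
    moreover have "init D' \<in> states D'" using D' by (simp add: dfa_def)
    ultimately show "g u \<in> states D'" using run run_states by blast
  qed
  moreover have "inj_on g (states D)"
  proof (rule inj_onI)
    fix u v assume uv: "u \<in> states D" "v \<in> states D" "g u = g v"
    then have "u @ x \<in> language D' \<longleftrightarrow> v @ x \<in> language D'" for x
      using run[OF uv(1)] run[OF uv(2)] uv(3) by (simp add: language_def run_append)
    then show "u = v" using sep[OF uv(1,2)] D' by blast
  qed
  ultimately show "card (states D) \<le> card (states D')"
    using D' by (intro card_inj_on_le[of g]) (simp_all add: dfa_def)
qed (rule assms(1))

theorem theorem4:
  fixes A :: "'a set" and w :: "'a list" and M :: "'a list set"
  assumes "finite A"
    and "w \<in> lists A"
    and "primitive_circular (circular_word w)"
    and "M = minimal_forbidden A (star_factors w)"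
  shows "finite M \<and> antifactorial M \<and>
    (\<forall>ls ps. distinct ls \<and> set ls = A \<and> breadth_first_order (trie A M) ps \<longrightarrow>
       (let N = remove_states (finals (trie A M)) (L_automaton (trie A M) ls ps)
        in language N = star_factors w \<and> minimal_dfa TYPE('q) N))"
proof -
  have prim: "primitive w" using assms(3) by (simp add: primitive_circular_iff)
  then have w: "w \<noteq> []" by (rule primitive_not_Nil)
  interpret factorial_language A "star_factors w"
  proof
    show "star_factors w \<subseteq> lists A" by (rule star_factors_subset_lists[OF assms(2)])
    show "[] \<in> star_factors w" by (simp add: star_factors_def)
    show "u \<in> star_factors w" if "v \<in> star_factors w" "sublist u v" for u v
      using that by (rule star_factors_sublist)
  qed
  have fin: "finite M"
    unfolding assms(4) by (rule finite_minimal_forbidden_star_factors[OF assms(1) prim])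
  have not_longer: "\<not> length v < length u"
    if u: "u \<in> Q - M" and v: "v \<in> Q - M"
      and same: "\<And>x. u @ x \<in> star_factors w \<longleftrightarrow> v @ x \<in> star_factors w" for u v
  proof
    assume less: "length v < length u"
    obtain x where "length x = length w" "u @ x \<in> star_factors w"
      using star_factors_extend[OF w] state_mem_L u assms(4) by blast
    then have "suffix v u"
      using star_factors_common_extension[OF prim, of x v u] same less by simp
    moreover obtain a u' where u': "u = a # u'" using less by (cases u) auto
    ultimately have suf: "suffix v u'" using less by (auto simp: suffix_Cons)
    \<comment> \<open>The first letter of \<open>u\<close> is also that of the minimal forbidden
      word \<open>u @ y\<close>, so \<open>tl\<close> turns this word into the factor
      \<open>u' @ y\<close>.\<close>
    obtain y where y: "u @ y \<in> M"
      using state_proper_prefix[of u] u u' assms(4) by blast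
    then have "u' @ y \<in> star_factors w"
      using minimal_forbidden_butlast_tl(2)[OF _ L_Nil, of "u @ y" A] assms(4) u' by simp
    moreover have "sublist (v @ y) (u' @ y)"
      using suf unfolding suffix_def sublist_def by (metis append.assoc append_Nil2)
    ultimately have "v @ y \<in> star_factors w"
      by (rule star_factors_sublist)
    then show False
      using same y assms(4) minimal_forbidden_not_mem by blast
  qed
  have "minimal_dfa TYPE('q) (trimmed ls ps)"
    if ls: "set ls = A" and ps: "breadth_first_order (trie A M) ps" for ls ps
  proof (rule minimal_dfaI)
    have lang: "language (trimmed ls ps) = star_factors w"
      using language_trimmed ls ps assms(4) by simp
    show "dfa (trimmed ls ps)"
      using dfa_trimmed assms(1,4) fin ls ps by simp
    show "states (trimmed ls ps) \<subseteq> language (trimmed ls ps)"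
      using lang state_mem_L by auto
    fix u v
    assume uv: "u \<in> states (trimmed ls ps)" "v \<in> states (trimmed ls ps)"
      and same: "\<And>x. u @ x \<in> language (trimmed ls ps) \<longleftrightarrow> v @ x \<in> language (trimmed ls ps)"
    \<comment> \<open>Applying \<open>not_longer\<close> both ways leaves only states of equal
      length. A common extension of length \<open>length w\<close> then makes \<open>v\<close> a
      suffix of \<open>u\<close>, hence equal to it.\<close>
    have len: "length u = length v"
      using not_longer[of u v] not_longer[of v u] uv same
      unfolding lang by (force simp: assms(4))
    have "u \<in> star_factors w"
      using state_mem_L uv(1) assms(4) by simp
    then obtain x where x: "length x = length w" "u @ x \<in> star_factors w"
      using star_factors_extend[OF w] by blast
    have "v @ x \<in> star_factors w" using same x(2) unfolding lang by blast
    then have "suffix v u"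
      by (rule star_factors_common_extension[OF prim _ _ x(2), rotated 2]) (simp_all add: x(1) len)
    then show "u = v" using len by (auto simp: suffix_def)
  qed
  then show ?thesis
    using fin M_antifactorial language_trimmed assms(4) by (simp add: Let_def trimmed_def)
qed

end
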